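(* Let $A\subset\mathbb R$ be a countable dense subset of $\mathbb R$ and let $B\subset\mathbb C$ be a countable dense subset of $\mathbb C$. There exists a transcendental entire function $f$ such that (i) $f|_A\colon A\to B$ is a bijection; (ii) $f^{-1}(B)\cap\mathbb R=A$; and (iii) $f'(a)\neq 0$ for every $a\in A$.
   Context: A transcendental entire function is an entire function $f\colon\mathbb C\to\mathbb C$ that is not a polynomial. *)

theory Defs
  imports "HOL-Analysis.Analysis" "HOL-Computational_Algebra.Polynomial"
begin

definition transcendental_entire :: "(complex \<Rightarrow> complex) \<Rightarrow> bool" where
  "transcendental_entire f \<longleftrightarrow>
     f holomorphic_on UNIV \<and> \<not> (\<exists>p :: complex poly. \<forall>z. f z = poly p z)"

end

theory Submission
  imports Defs "HOL-Complex_Analysis.Complex_Analysis"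
begin

text \<open>The function is a limit of polynomials \<open>p n\<close>, built by back-and-forth together with finite node
  sets \<open>D n \<subseteq> A\<close> on which \<open>p n\<close> is already final. Each step is a perturbation by a multiple of the
  polynomial vanishing at the nodes, small on the disc of radius \<open>n\<close>; it adds the next point of \<open>A\<close>
  and a preimage of the next point of \<open>B\<close>. A further generic perturbation makes \<open>p n - p n a\<close> vanish
  on the real line only at \<open>a\<close>, and to first order, so that \<open>\<bar>p n x - p n a\<bar> \<ge> 2 * e n * \<bar>x - a\<bar>\<close> for
  real \<open>\<bar>x\<bar> \<le> n\<close>. All later changes are at most \<open>e n * \<bar>z - a\<bar>\<close>, hence the limit keeps half of this
  bound, which gives uniqueness of real preimages and non-vanishing of the derivative at once.
  The limit is not a polynomial, because a polynomial maps bounded real intervals to compact null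
  sets, and these cannot contain a dense subset of the unit disc.\<close>

section \<open>Polynomials vanishing at finitely many nodes, and small changes that fix the
  nodes\<close>

definition node_poly :: "real set \<Rightarrow> complex poly" where
  "node_poly D = (\<Prod>a\<in>D. [:- complex_of_real a, 1:])"

text \<open>The bound proportional to the distance from each node limits the loss of slope there and
  so lets separation survive the limit. The plain bound by \<open>e\<close> gives locally uniform
  convergence.\<close>

definition close_poly :: "real set \<Rightarrow> real \<Rightarrow> real \<Rightarrow> complex poly \<Rightarrow> complex poly \<Rightarrow> bool" where
  "close_poly D R e p q \<longleftrightarrow>
     (\<forall>a\<in>D. poly q (complex_of_real a) = poly p (complex_of_real a)) \<and>
     (\<forall>z. cmod z \<le> R \<longrightarrow> cmod (poly q z - poly p z) \<le> e \<and>
        (\<forall>a\<in>D. cmod (poly q z - poly p z) \<le> e * cmod (z - complex_of_real a)))"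

lemma poly_node_poly_eq_0_iff:
  "finite D \<Longrightarrow> poly (node_poly D) z = 0 \<longleftrightarrow> z \<in> complex_of_real ` D"
  by (auto simp: node_poly_def poly_prod)

lemma node_poly_remove:
  assumes "finite D" "a \<in> D"
  shows "node_poly D = [:- complex_of_real a, 1:] * node_poly (D - {a})"
  unfolding node_poly_def by (rule prod.remove[OF assms])

lemma poly_bounded_on_cball:
  fixes p :: "complex poly"
  shows "\<exists>K>0. \<forall>z. cmod z \<le> R \<longrightarrow> cmod (poly p z) \<le> K"
proof -
  have "compact (poly p ` cball 0 R)"
    by (intro compact_continuous_image continuous_intros) auto
  then have "bounded (poly p ` cball 0 R)" by (rule compact_imp_bounded)
  then show ?thesis by (auto simp: bounded_pos)
qed

text \<open>Dividing by \<open>z - a\<close> leaves the node polynomial of \<open>D - {a}\<close>,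
  which is bounded on the disc. As \<open>D\<close> is finite, one constant dominates all these
  bounds and the plain one.\<close>

lemma node_poly_bound:
  assumes "finite D"
  shows "\<exists>K>0. \<forall>z. cmod z \<le> R \<longrightarrow> cmod (poly (node_poly D) z) \<le> K \<and>
      (\<forall>a\<in>D. cmod (poly (node_poly D) z) \<le> K * cmod (z - complex_of_real a))"
proof -
  obtain K0 where K0: "K0 > 0" "\<And>z. cmod z \<le> R \<Longrightarrow> cmod (poly (node_poly D) z) \<le> K0"
    using poly_bounded_on_cball by meson
  have "\<forall>a. \<exists>K>0. \<forall>z. cmod z \<le> R \<longrightarrow> cmod (poly (node_poly (D - {a})) z) \<le> K"
    using poly_bounded_on_cball by blast
  then obtain k where k: "\<And>a. k a > 0"
      "\<And>a z. cmod z \<le> R \<Longrightarrow> cmod (poly (node_poly (D - {a})) z) \<le> k a"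
    by metis
  define K where "K = K0 + (\<Sum>a\<in>D. k a)"
  have K: "K0 \<le> K" "\<And>a. a \<in> D \<Longrightarrow> k a \<le> K"
  proof -
    show "K0 \<le> K" unfolding K_def using k(1) by (simp add: sum_nonneg less_imp_le)
    fix a assume "a \<in> D"
    then have "k a \<le> (\<Sum>a\<in>D. k a)" using assms k(1) by (intro member_le_sum) (auto intro: less_imp_le)
    then show "k a \<le> K" unfolding K_def using K0 by simp
  qed
  have "cmod (poly (node_poly D) z) \<le> K * cmod (z - complex_of_real a)"
    if "cmod z \<le> R" "a \<in> D" for z a
  proof -
    have "cmod (poly (node_poly D) z) = cmod (poly (node_poly (D - {a})) z) * cmod (z - complex_of_real a)"
      unfolding node_poly_remove[OF assms that(2)] poly_mult norm_mult by (simp add: mult.commute)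
    also have "\<dots> \<le> K * cmod (z - complex_of_real a)"
      using k(2)[OF that(1), of a] K(2)[OF that(2)] by (intro mult_right_mono) auto
    finally show ?thesis .
  qed
  moreover have "K > 0" "\<And>z. cmod z \<le> R \<Longrightarrow> cmod (poly (node_poly D) z) \<le> K"
    using K0 K(1) by force+
  ultimately show ?thesis by (intro exI[of _ K]) simp
qed

text \<open>All three kinds of perturbation below have this shape, with \<open>h\<close> a constant
  or a monomial, so that only the size of \<open>h\<close> on the disc has to be checked.\<close>

lemma close_poly_add:
  assumes "finite D"
    and K: "\<And>z. cmod z \<le> R \<Longrightarrow> cmod (poly (node_poly D) z) \<le> K \<and>
      (\<forall>a\<in>D. cmod (poly (node_poly D) z) \<le> K * cmod (z - complex_of_real a))"
    and h: "\<And>z. cmod z \<le> R \<Longrightarrow> cmod (poly h z) * K \<le> e"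
  shows "close_poly D R e p (p + node_poly D * h)"
  unfolding close_poly_def
proof (intro conjI ballI allI impI)
  fix a assume "a \<in> D"
  then show "poly (p + node_poly D * h) (complex_of_real a) = poly p (complex_of_real a)"
    using poly_node_poly_eq_0_iff[OF assms(1), of "complex_of_real a"] by simp
next
  fix z :: complex assume z: "cmod z \<le> R"
  have eq: "cmod (poly (p + node_poly D * h) z - poly p z) = cmod (poly h z) * cmod (poly (node_poly D) z)"
    by (simp add: norm_mult mult.commute)
  show "cmod (poly (p + node_poly D * h) z - poly p z) \<le> e"
    unfolding eq using K[OF z] h[OF z] by (meson mult_left_mono norm_ge_zero order_trans)
  fix a assume a: "a \<in> D"
  have "cmod (poly h z) * cmod (poly (node_poly D) z) \<le> cmod (poly h z) * (K * cmod (z - complex_of_real a))"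
    using K[OF z] a by (intro mult_left_mono) auto
  also have "\<dots> = (cmod (poly h z) * K) * cmod (z - complex_of_real a)" by simp
  also have "\<dots> \<le> e * cmod (z - complex_of_real a)"
    using h[OF z] by (rule mult_right_mono) simp
  finally show "cmod (poly (p + node_poly D * h) z - poly p z) \<le> e * cmod (z - complex_of_real a)"
    unfolding eq .
qed

lemma close_poly_refl: "e \<ge> 0 \<Longrightarrow> close_poly D R e p p"
  by (simp add: close_poly_def)

lemma close_poly_trans:
  assumes "close_poly D R d p q" "close_poly D' R e q r" "D \<subseteq> D'"
  shows "close_poly D R (d + e) p r"
  unfolding close_poly_def
proof (intro conjI ballI allI impI)
  fix a assume "a \<in> D"
  then show "poly r (complex_of_real a) = poly p (complex_of_real a)"
    using assms by (auto simp: close_poly_def)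
next
  fix z :: complex assume z: "cmod z \<le> R"
  have tri: "cmod (poly r z - poly p z) \<le> cmod (poly q z - poly p z) + cmod (poly r z - poly q z)"
    using norm_triangle_ineq[of "poly q z - poly p z" "poly r z - poly q z"] by simp
  have "cmod (poly q z - poly p z) \<le> d" "cmod (poly r z - poly q z) \<le> e"
    using assms z by (auto simp: close_poly_def)
  then show "cmod (poly r z - poly p z) \<le> d + e" using tri by linarith
  fix a assume a: "a \<in> D"
  then have "cmod (poly q z - poly p z) \<le> d * cmod (z - complex_of_real a)"
      "cmod (poly r z - poly q z) \<le> e * cmod (z - complex_of_real a)"
    using assms z by (auto simp: close_poly_def)
  then show "cmod (poly r z - poly p z) \<le> (d + e) * cmod (z - complex_of_real a)"
    using tri by (simp add: algebra_simps)
qed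

lemma close_poly_inj_on:
  assumes "close_poly D R e p q" "inj_on (\<lambda>a. poly p (complex_of_real a)) D"
  shows "inj_on (\<lambda>a. poly q (complex_of_real a)) D"
  using assms by (auto simp: close_poly_def inj_on_def)

section \<open>Adding a point of the domain or of the range\<close>

lemma dense_meets_open:
  assumes "closure S = UNIV" "open U" "U \<noteq> {}"
  shows "\<exists>x\<in>S. x \<in> U"
  using open_Int_closure_eq_empty[OF assms(2), of S] assms(1,3) by auto

text \<open>Adding small constant multiples of the node polynomial moves the value at
  \<open>a\<close> through a whole disc. The dense set \<open>B\<close> meets this disc outside the
  finitely many values already taken; avoiding these preserves injectivity on the nodes.\<close>

lemma perturb_value_into_dense:
  assumes "finite D" "a \<notin> D" "e > 0" "closure B = UNIV"
  shows "\<exists>q. close_poly D R e p q \<and> poly q (complex_of_real a) \<in> B \<and>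
    poly q (complex_of_real a) \<notin> (\<lambda>x. poly p (complex_of_real x)) ` D"
proof -
  obtain K where K: "K > 0" "\<And>z. cmod z \<le> R \<Longrightarrow> cmod (poly (node_poly D) z) \<le> K \<and>
      (\<forall>a\<in>D. cmod (poly (node_poly D) z) \<le> K * cmod (z - complex_of_real a))"
    using node_poly_bound[OF assms(1), of R] by blast
  define F where "F = (\<lambda>x. poly p (complex_of_real x)) ` D"
  define u where "u = poly (node_poly D) (complex_of_real a)"
  have u: "u \<noteq> 0"
    unfolding u_def using assms(2) poly_node_poly_eq_0_iff[OF assms(1)] by auto
  have "finite F" unfolding F_def using assms(1) by simp
  \<comment> \<open>The multiple \<open>c\<close> moves the value at \<open>a\<close> by
    \<open>c * u\<close>, and \<open>cmod c * K \<le> e\<close> is required; hence this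
    radius.\<close>
  define r where "r = e * cmod u / K"
  have r: "r > 0" unfolding r_def using u K(1) assms(3) by simp
  define w where "w = poly p (complex_of_real a)"
  have "open (ball w r - F)" using \<open>finite F\<close> by (simp add: open_Diff finite_imp_closed)
  moreover have "ball w r - F \<noteq> {}"
    using \<open>finite F\<close> r uncountable_ball[of r w] by (metis Diff_eq_empty_iff countable_finite countable_subset)
  ultimately obtain b where b: "b \<in> B" "b \<in> ball w r" "b \<notin> F"
    using dense_meets_open[OF assms(4)] by blast
  define c where "c = (b - w) / u"
  have "cmod c * K \<le> e"
  proof -
    have "cmod (b - w) < r" using b by (simp add: dist_norm norm_minus_commute)
    then have "cmod (b - w) * K < e * cmod u"
      unfolding r_def using K(1) by (simp add: field_simps)
    then show ?thesis unfolding c_def using u by (simp add: norm_divide field_simps)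
  qed
  then have "close_poly D R e p (p + node_poly D * [:c:])"
    by (intro close_poly_add[OF assms(1) K(2)]) auto
  moreover have "poly (p + node_poly D * [:c:]) (complex_of_real a) = b"
    using u by (simp add: u_def[symmetric] w_def[symmetric] c_def)
  ultimately show ?thesis using b unfolding F_def by (intro exI[of _ "p + node_poly D * [:c:]"]) auto
qed

text \<open>The new node is taken outside the disc of radius \<open>R\<close>, where the factor \<open>(z / a) ^ N\<close> is as
  small as desired on the disc and equal to 1 at the node.\<close>

lemma perturb_attain_value:
  assumes "finite D" "e > 0" "closure A = UNIV"
  shows "\<exists>q. \<exists>a\<in>A - D. close_poly D R e p q \<and> poly q (complex_of_real a) = b"
proof -
  obtain K where K: "K > 0" "\<And>z. cmod z \<le> R \<Longrightarrow> cmod (poly (node_poly D) z) \<le> K \<and>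
      (\<forall>a\<in>D. cmod (poly (node_poly D) z) \<le> K * cmod (z - complex_of_real a))"
    using node_poly_bound[OF assms(1), of R] by blast
  \<comment> \<open>A point beyond \<open>M\<close> is a new node and lies outside the disc, so that
    the ratio \<open>t\<close> below is less than 1.\<close>
  define M where "M = Max (insert \<bar>R\<bar> D)"
  have M: "\<bar>R\<bar> \<le> M" "\<And>x. x \<in> D \<Longrightarrow> x \<le> M" unfolding M_def using assms(1) by auto
  obtain a where a: "a \<in> A" "a > M"
    using dense_meets_open[OF assms(3), of "{M<..}"] by auto
  have "a \<notin> D" using M a by force
  define u where "u = poly (node_poly D) (complex_of_real a)"
  have u: "u \<noteq> 0"
    unfolding u_def using \<open>a \<notin> D\<close> poly_node_poly_eq_0_iff[OF assms(1)] by auto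
  define c where "c = (b - poly p (complex_of_real a)) / u"
  define t where "t = \<bar>R\<bar> / a"
  have t: "0 \<le> t" "t < 1" and apos: "a > 0" unfolding t_def using M a by (auto simp: field_simps)
  \<comment> \<open>The summand 1 keeps the denominator positive when \<open>c = 0\<close>.\<close>
  obtain N where N: "t ^ N < e / ((cmod c + 1) * K)"
    using real_arch_pow_inv[of "e / ((cmod c + 1) * K)" t] t assms(2) K(1)
    by (metis add_nonneg_pos divide_pos_pos mult_pos_pos norm_ge_zero zero_less_one)
  define h where "h = monom (c / complex_of_real a ^ N) N"
  have "cmod (poly h z) * K \<le> e" if "cmod z \<le> R" for z
  proof -
    have "cmod (poly h z) = cmod c * (cmod z / a) ^ N"
      using apos by (simp add: h_def poly_monom norm_mult norm_divide norm_power power_divide)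
    also have "\<dots> \<le> (cmod c + 1) * t ^ N"
      using that apos by (intro mult_mono power_mono) (auto simp: t_def divide_right_mono)
    finally have "cmod (poly h z) * K \<le> (cmod c + 1) * t ^ N * K"
      using K(1) by (simp add: mult_right_mono)
    also have "\<dots> = t ^ N * ((cmod c + 1) * K)" by simp
    also have "\<dots> \<le> e"
      using N K(1) by (subst (asm) pos_less_divide_eq) (auto intro!: mult_pos_pos add_nonneg_pos)
    finally show ?thesis .
  qed
  with close_poly_add[OF assms(1) K(2)] have "close_poly D R e p (p + node_poly D * h)"
    by simp
  moreover have "poly (p + node_poly D * h) (complex_of_real a) = b"
    using u apos by (simp add: u_def[symmetric] c_def h_def poly_monom)
  ultimately show ?thesis using a \<open>a \<notin> D\<close> by blast
qed

section \<open>Null sets in the plane and generic separation\<close>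

lemma differentiable_poly_quotient:
  fixes p q :: "complex poly"
  assumes "poly q (complex_of_real x) \<noteq> 0"
  shows "(\<lambda>x. poly p (complex_of_real x) / poly q (complex_of_real x)) differentiable (at x within S)"
proof -
  have "((\<lambda>z. poly p z / poly q z) has_field_derivative
      (poly (pderiv p) (complex_of_real x) * poly q (complex_of_real x)
       - poly p (complex_of_real x) * poly (pderiv q) (complex_of_real x))
      / (poly q (complex_of_real x) * poly q (complex_of_real x))) (at (complex_of_real x))"
    by (intro DERIV_divide poly_DERIV assms)
  from has_vector_derivative_real_field[OF this] show ?thesis
    by (rule differentiableI_vector)
qed

text \<open>A differentiable image of a subset of the line is null in the plane, which has real
  dimension 2. Denominator 1 gives the case of polynomial curves.\<close>

lemma negligible_poly_quotient_image:
  fixes p q :: "complex poly"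
  assumes "\<And>x. x \<in> S \<Longrightarrow> poly q (complex_of_real x) \<noteq> 0"
  shows "negligible ((\<lambda>x. poly p (complex_of_real x) / poly q (complex_of_real x)) ` S)"
  by (rule negligible_differentiable_image_lowdim)
     (auto simp: differentiable_on_def intro!: differentiable_poly_quotient assms)

lemma poly_nonzero_bounded_below:
  fixes g :: "complex poly"
  assumes "\<And>x. poly g (complex_of_real x) \<noteq> 0"
  shows "\<exists>m>0. \<forall>x. \<bar>x\<bar> \<le> R \<longrightarrow> m \<le> cmod (poly g (complex_of_real x))"
proof (cases "R < 0")
  case True
  then show ?thesis by (intro exI[of _ 1]) auto
next
  case False
  have "continuous_on {-R..R} (\<lambda>x. cmod (poly g (complex_of_real x)))"
    by (intro continuous_intros)
  then obtain y where "\<forall>x\<in>{-R..R}. cmod (poly g (complex_of_real y)) \<le> cmod (poly g (complex_of_real x))"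
    using continuous_attains_inf[of "{-R..R}"] False by fastforce
  then show ?thesis
    using assms[of y] by (intro exI[of _ "cmod (poly g (complex_of_real y))"]) (auto simp: abs_le_iff)
qed

text \<open>Writing \<open>p - p a = (z - a) * Q a\<close> and \<open>node_poly D = (z - a) * P a\<close>, the conclusion holds for
  \<open>p + c * node_poly D\<close> as soon as no \<open>Q a + c * P a\<close> has a real zero, which excludes a Lebesgue
  null set of parameters \<open>c\<close>.\<close>

lemma perturb_separate:
  assumes "finite D" "e > 0" and inj: "inj_on (\<lambda>a. poly p (complex_of_real a)) D"
  shows "\<exists>q m. close_poly D R e p q \<and> m > 0 \<and> (\<forall>a\<in>D. \<forall>x. \<bar>x\<bar> \<le> R' \<longrightarrow>
    m * \<bar>x - a\<bar> \<le> cmod (poly q (complex_of_real x) - poly q (complex_of_real a)))"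
proof -
  obtain K where K: "K > 0" "\<And>z. cmod z \<le> R \<Longrightarrow> cmod (poly (node_poly D) z) \<le> K \<and>
      (\<forall>a\<in>D. cmod (poly (node_poly D) z) \<le> K * cmod (z - complex_of_real a))"
    using node_poly_bound[OF assms(1), of R] by blast
  have "\<forall>a. \<exists>Q. p - [:poly p (complex_of_real a):] = [:- complex_of_real a, 1:] * Q"
  proof
    fix a
    have "poly (p - [:poly p (complex_of_real a):]) (complex_of_real a) = 0" by simp
    then show "\<exists>Q. p - [:poly p (complex_of_real a):] = [:- complex_of_real a, 1:] * Q"
      unfolding poly_eq_0_iff_dvd dvd_def .
  qed
  then obtain Q where Q: "\<And>a. p - [:poly p (complex_of_real a):] = [:- complex_of_real a, 1:] * Q a"
    by metis
  have Qv: "poly p z - poly p (complex_of_real a) = (z - complex_of_real a) * poly (Q a) z" for a z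
    using arg_cong[OF Q[of a], of "\<lambda>g. poly g z"] by (simp add: algebra_simps)
  define P where "P a = node_poly (D - {a})" for a
  define bad where "bad a = (\<lambda>x. poly (- Q a) (complex_of_real x) / poly (P a) (complex_of_real x)) `
      {x. poly (P a) (complex_of_real x) \<noteq> 0}" for a
  have "negligible (\<Union> (bad ` D))"
  proof (rule negligible_Union)
    show "finite (bad ` D)" using assms(1) by simp
    show "negligible T" if "T \<in> bad ` D" for T
      using that unfolding bad_def by (auto simp del: poly_minus intro!: negligible_poly_quotient_image)
  qed
  \<comment> \<open>A disc of positive measure is not covered by finitely many null sets; the radius
    \<open>e / K\<close> keeps the perturbation within \<open>e\<close>.\<close>
  moreover have "\<not> negligible (ball (0::complex) (e / K))"
    using divide_pos_pos[OF assms(2) K(1)] by (intro open_not_negligible) auto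
  ultimately have "\<not> ball 0 (e / K) \<subseteq> \<Union> (bad ` D)"
    by (meson negligible_subset)
  then obtain c where c: "c \<in> ball 0 (e / K)" "\<And>a. a \<in> D \<Longrightarrow> c \<notin> bad a" by blast
  define q where "q = p + node_poly D * [:c:]"
  have "cmod c * K \<le> e" using c(1) K(1) by (simp add: field_simps)
  then have close: "close_poly D R e p q"
    unfolding q_def by (intro close_poly_add[OF assms(1) K(2)]) auto
  have nz: "poly (Q a + smult c (P a)) (complex_of_real x) \<noteq> 0" if "a \<in> D" for a x
  proof (cases "poly (P a) (complex_of_real x) = 0")
    case True
    \<comment> \<open>The real zeros of \<open>P a\<close> are the other nodes, where
      \<open>Q a\<close> is nonzero by injectivity, whatever \<open>c\<close> is.\<close>
    then have "x \<in> D" "x \<noteq> a"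
      unfolding P_def using poly_node_poly_eq_0_iff[of "D - {a}"] assms(1) by auto
    then have "poly p (complex_of_real x) \<noteq> poly p (complex_of_real a)"
      using inj that by (auto dest: inj_onD)
    then show ?thesis using Qv[of "complex_of_real x" a] True by auto
  next
    case False
    then have "c \<noteq> - poly (Q a) (complex_of_real x) / poly (P a) (complex_of_real x)"
      using c(2)[OF that] unfolding bad_def by auto
    then show ?thesis using False by (auto simp: field_simps add_eq_0_iff)
  qed
  have "\<forall>a\<in>D. \<exists>m>0. \<forall>x. \<bar>x\<bar> \<le> R' \<longrightarrow> m \<le> cmod (poly (Q a + smult c (P a)) (complex_of_real x))"
    using poly_nonzero_bounded_below nz by blast
  then obtain m where m: "\<And>a. a \<in> D \<Longrightarrow> m a > 0"
    "\<And>a x. a \<in> D \<Longrightarrow> \<bar>x\<bar> \<le> R' \<Longrightarrow> m a \<le> cmod (poly (Q a + smult c (P a)) (complex_of_real x))"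
    by metis
  define m0 where "m0 = Min (insert 1 (m ` D))"
  have m0: "m0 > 0" "\<And>a. a \<in> D \<Longrightarrow> m0 \<le> m a"
    unfolding m0_def using assms(1) m(1) by (auto intro: Min_le)
  have "m0 * \<bar>x - a\<bar> \<le> cmod (poly q (complex_of_real x) - poly q (complex_of_real a))"
    if "a \<in> D" "\<bar>x\<bar> \<le> R'" for a x
  proof -
    have "poly q (complex_of_real x) - poly q (complex_of_real a)
        = (poly p (complex_of_real x) - poly p (complex_of_real a)) + c * poly (node_poly D) (complex_of_real x)"
      using poly_node_poly_eq_0_iff[OF assms(1), of "complex_of_real a"] that(1) by (simp add: q_def)
    also have "\<dots> = (complex_of_real x - complex_of_real a) * poly (Q a + smult c (P a)) (complex_of_real x)"
      unfolding Qv node_poly_remove[OF assms(1) that(1)] by (simp add: P_def algebra_simps)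
    finally have "cmod (poly q (complex_of_real x) - poly q (complex_of_real a))
        = cmod (poly (Q a + smult c (P a)) (complex_of_real x)) * \<bar>x - a\<bar>"
      by (metis mult.commute norm_mult norm_of_real of_real_diff)
    then show ?thesis
      using m(2)[OF that] m0(2)[OF that(1)] by (simp add: mult_right_mono del: poly_add)
  qed
  then show ?thesis using close m0(1) by blast
qed

text \<open>A nonconstant polynomial tends to infinity, so only a bounded interval can reach the
  unit disc. The image of that interval is closed, so containing a dense part of the disc it would
  contain the whole disc, contrary to its measure 0.\<close>

lemma poly_not_covers_dense:
  fixes p :: "complex poly"
  assumes "closure B = UNIV"
  shows "\<not> B \<subseteq> (\<lambda>x. poly p (complex_of_real x)) ` UNIV"
proof
  assume sub: "B \<subseteq> (\<lambda>x. poly p (complex_of_real x)) ` UNIV"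
  have "\<exists>M. \<forall>x. \<bar>x\<bar> > M \<longrightarrow> poly p (complex_of_real x) \<notin> ball 0 1"
  proof (cases "degree p = 0")
    case True
    then obtain c where "p = [:c:]" by (rule degree_eq_zeroE)
    then have "B \<subseteq> {c}" using sub by auto
    then have "closure B \<subseteq> {c}" by (meson closed_singleton closure_minimal)
    then show ?thesis using assms by (metis UNIV_I singletonD subsetD zero_neq_one)
  next
    case False
    then have "filterlim (poly p) at_infinity at_infinity"
      by (intro filterlim_poly_at_infinity) auto
    then have "eventually (\<lambda>z. cmod (poly p z) \<ge> 1) at_infinity"
      by (auto simp: filterlim_at_infinity[of 0])
    then obtain M where "\<And>z. cmod z \<ge> M \<Longrightarrow> cmod (poly p z) \<ge> 1"
      unfolding eventually_at_infinity by blast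
    then show ?thesis by (intro exI[of _ M]) (auto simp: not_less)
  qed
  then obtain M where M: "\<And>x. poly p (complex_of_real x) \<in> ball 0 1 \<Longrightarrow> \<bar>x\<bar> \<le> M"
    by (meson not_le)
  define I where "I = (\<lambda>x. poly p (complex_of_real x)) ` {-M..M}"
  have "closed I"
    unfolding I_def by (intro compact_imp_closed compact_continuous_image continuous_intros) auto
  have "ball 0 1 \<inter> B \<subseteq> I"
    using sub M unfolding I_def by (force simp: abs_le_iff)
  moreover have "ball 0 1 \<subseteq> closure (ball 0 1 \<inter> B)"
    using open_Int_closure_subset[of "ball 0 1" B] assms by auto
  ultimately have "ball 0 1 \<subseteq> I"
    using \<open>closed I\<close> by (meson closure_minimal order_trans)
  moreover have "negligible I"
    using negligible_poly_quotient_image[of "{-M..M}" 1 p] unfolding I_def by simp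
  ultimately show False
    using open_not_negligible[of "ball (0::complex) 1"] negligible_subset by auto
qed

section \<open>One step of the back-and-forth\<close>

definition node_state :: "real set \<Rightarrow> complex set \<Rightarrow> real \<Rightarrow> complex poly \<times> real set \<times> real \<Rightarrow> bool" where
  "node_state A B R = (\<lambda>(p, D, e). finite D \<and> D \<subseteq> A \<and> e > 0 \<and>
     inj_on (\<lambda>a. poly p (complex_of_real a)) D \<and> (\<lambda>a. poly p (complex_of_real a)) ` D \<subseteq> B \<and>
     (\<forall>a\<in>D. \<forall>x. \<bar>x\<bar> \<le> R \<longrightarrow>
        2 * e * \<bar>x - a\<bar> \<le> cmod (poly p (complex_of_real x) - poly p (complex_of_real a))))"

text \<open>Three perturbations of size \<open>e / 6\<close> admit \<open>a\<close>, attain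
  \<open>b\<close> and separate the nodes. Closeness refers to the old radius \<open>R\<close>,
  separation to the new radius \<open>R'\<close>.\<close>

lemma node_state_step:
  assumes st: "node_state A B R (p, D, e)" and ab: "a \<in> A" "b \<in> B"
    and dense: "closure A = UNIV" "closure B = UNIV"
  shows "\<exists>q D' d. node_state A B R' (q, D', d) \<and> D \<subseteq> D' \<and> d \<le> e / 2 \<and>
    close_poly D R (e / 2) p q \<and> a \<in> D' \<and> b \<in> (\<lambda>a. poly q (complex_of_real a)) ` D'"
proof -
  let ?v = "\<lambda>p a. poly p (complex_of_real a)"
  have D: "finite D" "D \<subseteq> A" "e > 0" "inj_on (?v p) D" "?v p ` D \<subseteq> B"
    using st by (auto simp: node_state_def)
  have img: "?v q ` D' = ?v p ` D'" if "close_poly D' R d p q" for p q D' d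
    using that by (auto simp: close_poly_def)
  have "\<exists>q. close_poly D R (e / 6) p q \<and> inj_on (?v q) (insert a D) \<and> ?v q ` insert a D \<subseteq> B"
  proof (cases "a \<in> D")
    case True
    then show ?thesis using D by (intro exI[of _ p]) (auto simp: close_poly_refl insert_absorb)
  next
    case False
    then obtain q where q: "close_poly D R (e / 6) p q" "?v q a \<in> B" "?v q a \<notin> ?v p ` D"
      using perturb_value_into_dense[OF D(1) False _ dense(2), of "e / 6" R p] D(3) by auto
    then show ?thesis
      using close_poly_inj_on[OF q(1) D(4)] img[OF q(1)] D(5) False by (intro exI[of _ q]) auto
  qed
  then obtain q1 where q1: "close_poly D R (e / 6) p q1" "inj_on (?v q1) (insert a D)"
      "?v q1 ` insert a D \<subseteq> B" by blast
  define D1 where "D1 = insert a D"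
  have D1: "finite D1" "D1 \<subseteq> A" unfolding D1_def using D ab by auto
  have "\<exists>q a2. a2 \<in> A \<and> close_poly D1 R (e / 6) q1 q \<and> inj_on (?v q) (insert a2 D1) \<and>
      ?v q ` insert a2 D1 \<subseteq> B \<and> b \<in> ?v q ` insert a2 D1"
  proof (cases "b \<in> ?v q1 ` D1")
    case True
    \<comment> \<open>When \<open>b\<close> is already attained, the node \<open>a\<close>, which
      lies in \<open>D1\<close>, serves as \<open>a2\<close>, and inserting it changes
      nothing.\<close>
    then show ?thesis using D(3) q1 ab
      by (intro exI[of _ q1] exI[of _ a]) (auto simp: close_poly_refl D1_def)
  next
    case False
    obtain q a2 where q: "a2 \<in> A - D1" "close_poly D1 R (e / 6) q1 q" "?v q a2 = b"
      using perturb_attain_value[OF D1(1) _ dense(1), of "e / 6" R q1 b] D(3) by auto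
    then show ?thesis
      using close_poly_inj_on[OF q(2)] img[OF q(2)] q1 False ab unfolding D1_def[symmetric]
      by (intro exI[of _ q] exI[of _ a2]) auto
  qed
  then obtain q2 a2 where q2: "a2 \<in> A" "close_poly D1 R (e / 6) q1 q2"
      "inj_on (?v q2) (insert a2 D1)" "?v q2 ` insert a2 D1 \<subseteq> B" "b \<in> ?v q2 ` insert a2 D1"
    by blast
  define D2 where "D2 = insert a2 D1"
  have D2: "finite D2" "D2 \<subseteq> A" unfolding D2_def using D1 q2 by auto
  obtain q m where q: "close_poly D2 R (e / 6) q2 q" "m > 0"
      "\<forall>a\<in>D2. \<forall>x. \<bar>x\<bar> \<le> R' \<longrightarrow> m * \<bar>x - a\<bar> \<le> cmod (?v q x - ?v q a)"
    using perturb_separate[OF D2(1) _ q2(3)[folded D2_def], of "e / 6" R R'] D(3) by auto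
  \<comment> \<open>The bound \<open>m / 2\<close> turns the slope \<open>m\<close> into
    \<open>2 * d\<close>; the bound \<open>e / 2\<close> keeps this step and all later changes
    within \<open>e\<close>.\<close>
  define d where "d = min (e / 2) (m / 2)"
  have d: "d > 0" "d \<le> e / 2" "2 * d \<le> m" unfolding d_def using D(3) q(2) by auto
  have "2 * d * \<bar>x - y\<bar> \<le> cmod (?v q x - ?v q y)" if "y \<in> D2" "\<bar>x\<bar> \<le> R'" for x y
    using q(3) that mult_right_mono[OF d(3), of "\<bar>x - y\<bar>"] by force
  then have "node_state A B R' (q, D2, d)"
    using D2 d close_poly_inj_on[OF q(1)] img[OF q(1)] q2 unfolding node_state_def D2_def[symmetric] by auto
  moreover have "close_poly D R (e / 2) p q"
    using close_poly_trans[OF close_poly_trans[OF q1(1) q2(2)] q(1)] by (auto simp: D1_def D2_def)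
  moreover have "D \<subseteq> D2" "a \<in> D2" by (auto simp: D1_def D2_def)
  moreover have "b \<in> ?v q ` D2" using q2(5) unfolding img[OF q(1)] D2_def[symmetric] .
  ultimately show ?thesis
    using d(2) by (intro exI[of _ q] exI[of _ D2] exI[of _ d] conjI)
qed

section \<open>The limit function and its properties\<close>

theorem corollary2p5:
  fixes A :: "real set" and B :: "complex set"
  assumes "countable A" and "closure A = UNIV"
    and "countable B" and "closure B = UNIV"
  shows "\<exists>f :: complex \<Rightarrow> complex.
    transcendental_entire f \<and>
    bij_betw f (complex_of_real ` A) B \<and>
    f -` B \<inter> \<real> = complex_of_real ` A \<and>
    (\<forall>a\<in>A. deriv f (complex_of_real a) \<noteq> 0)"
proof -
  let ?v = "\<lambda>p a. poly p (complex_of_real a)"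
  have ne: "A \<noteq> {}" "B \<noteq> {}" using assms by auto
  define as bs where "as = from_nat_into A" and "bs = from_nat_into B"
  have as: "range as = A" and bs: "range bs = B"
    unfolding as_def bs_def using assms ne by (auto intro!: range_from_nat_into)
  define Q where "Q = (\<lambda>n (p, D, e) (q, D', d). D \<subseteq> D' \<and> d \<le> e / 2 \<and>
      close_poly D (real n) (e / 2) p q \<and> as n \<in> D' \<and> bs n \<in> ?v q ` D')"
  have "\<exists>F. \<forall>n. node_state A B (real n) (F n) \<and> Q n (F n) (F (Suc n))"
  proof (rule dependent_nat_choice)
    show "\<exists>x. node_state A B (real 0) x"
      \<comment> \<open>Without nodes the conditions on values and slopes are vacuous.\<close>
      by (rule exI[of _ "(0, {}, 1)"]) (simp add: node_state_def)
    fix x n assume *: "node_state A B (real n) x"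
    obtain p D e where x: "x = (p, D, e)" by (cases x)
    have "as n \<in> A" "bs n \<in> B" using as bs by auto
    from node_state_step[OF *[unfolded x] this assms(2,4), of "real (Suc n)"]
    show "\<exists>y. node_state A B (real (Suc n)) y \<and> Q n x y"
      unfolding x Q_def by auto
  qed
  then obtain F where F: "\<And>n. node_state A B (real n) (F n)"
    "\<And>n. Q n (F n) (F (Suc n))" by blast
  define p D e where "p n = fst (F n)" and "D n = fst (snd (F n))" and "e n = snd (snd (F n))" for n
  have Feq: "F n = (p n, D n, e n)" for n by (simp add: p_def D_def e_def)
  have st: "D n \<subseteq> A" "e n > 0" "?v (p n) ` D n \<subseteq> B"
      "\<And>a x. a \<in> D n \<Longrightarrow> \<bar>x\<bar> \<le> real n \<Longrightarrow> 2 * e n * \<bar>x - a\<bar> \<le> cmod (?v (p n) x - ?v (p n) a)" for n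
    using F(1)[of n] unfolding Feq node_state_def by auto
  have step: "D n \<subseteq> D (Suc n)" "e (Suc n) \<le> e n / 2" "close_poly (D n) (real n) (e n / 2) (p n) (p (Suc n))"
      "as n \<in> D (Suc n)" "bs n \<in> ?v (p (Suc n)) ` D (Suc n)" for n
    using F(2)[of n] unfolding Feq Q_def by auto
  have Dmono: "D n \<subseteq> D m" if "n \<le> m" for n m
    using that by (rule lift_Suc_mono_le[of D, OF step(1)])
  \<comment> \<open>Since \<open>e (Suc m) \<le> e m / 2\<close>, the step error
    \<open>e m / 2\<close> is at most \<open>e m - e (Suc m)\<close>, and these differences
    telescope.\<close>
  have close: "close_poly (D n) (real n) (e n - e m) (p n) (p m)" if "n \<le> m" for n m
    using that
  proof (induction m rule: dec_induct)
    case base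
    then show ?case by (simp add: close_poly_refl)
  next
    case (step m)
    have "close_poly (D m) (real n) (e m - e (Suc m)) (p m) (p (Suc m))"
      unfolding close_poly_def
    proof (intro conjI ballI allI impI)
      fix a assume "a \<in> D m"
      then show "?v (p (Suc m)) a = ?v (p m) a"
        using \<open>close_poly (D m) (real m) (e m / 2) (p m) (p (Suc m))\<close> by (auto simp: close_poly_def)
    next
      have le: "e m / 2 \<le> e m - e (Suc m)" using \<open>e (Suc m) \<le> e m / 2\<close> by simp
      fix z :: complex assume "cmod z \<le> real n"
      then have z: "cmod z \<le> real m" using step.hyps by linarith
      then show "cmod (poly (p (Suc m)) z - poly (p m) z) \<le> e m - e (Suc m)"
        using \<open>close_poly (D m) (real m) (e m / 2) (p m) (p (Suc m))\<close> le by (force simp: close_poly_def)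
      fix a assume "a \<in> D m"
      then have "cmod (poly (p (Suc m)) z - poly (p m) z) \<le> e m / 2 * cmod (z - complex_of_real a)"
        using \<open>close_poly (D m) (real m) (e m / 2) (p m) (p (Suc m))\<close> z by (auto simp: close_poly_def)
      also have "\<dots> \<le> (e m - e (Suc m)) * cmod (z - complex_of_real a)"
        using le by (rule mult_right_mono) simp
      finally show "cmod (poly (p (Suc m)) z - poly (p m) z) \<le> (e m - e (Suc m)) * cmod (z - complex_of_real a)" .
    qed
    from close_poly_trans[OF step.IH this Dmono] step.hyps show ?case by simp
  qed
  have dist: "cmod (poly (p m) z - poly (p n) z) \<le> e n"
      "a \<in> D n \<Longrightarrow> cmod (poly (p m) z - poly (p n) z) \<le> e n * cmod (z - complex_of_real a)"
    if "n \<le> m" "cmod z \<le> real n" for n m z a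
  proof -
    have le: "e n - e m \<le> e n" using st(2)[of m] by simp
    show "cmod (poly (p m) z - poly (p n) z) \<le> e n"
      using close[OF that(1)] that(2) le by (force simp: close_poly_def)
    show "cmod (poly (p m) z - poly (p n) z) \<le> e n * cmod (z - complex_of_real a)" if "a \<in> D n"
    proof -
      have "cmod (poly (p m) z - poly (p n) z) \<le> (e n - e m) * cmod (z - complex_of_real a)"
        using close[OF \<open>n \<le> m\<close>] \<open>cmod z \<le> real n\<close> that by (auto simp: close_poly_def)
      also have "\<dots> \<le> e n * cmod (z - complex_of_real a)" using le by (rule mult_right_mono) simp
      finally show ?thesis .
    qed
  qed
  have e_le: "e n \<le> e 0 * (1 / 2) ^ n" for n
  proof (induction n)
    case (Suc n)
    then show ?case using step(2)[of n] by simp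
  qed simp
  have "(\<lambda>n. e 0 * (1 / 2) ^ n) \<longlonglongrightarrow> 0"
    by (intro tendsto_mult_right_zero LIMSEQ_realpow_zero) auto
  then have e_lim: "e \<longlonglongrightarrow> 0"
    by (rule tendsto_sandwich[OF _ _ tendsto_const, rotated -1])
       (use e_le st(2) in \<open>auto intro!: always_eventually less_imp_le\<close>)
  have e_small: "eventually (\<lambda>n. e n < r \<and> c \<le> real n) sequentially" if "r > 0" for r c
    using order_tendstoD(2)[OF e_lim that] filterlim_real_sequentially[unfolded filterlim_at_top]
    by (auto intro: eventually_conj)
  define f where "f z = lim (\<lambda>n. poly (p n) z)" for z
  have "Cauchy (\<lambda>n. poly (p n) z)" for z
  proof (rule metric_CauchyI)
    fix r :: real assume "r > 0"
    then obtain N where N: "e N < r / 2" "cmod z \<le> real N"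
      using e_small[of "r / 2" "cmod z"] unfolding eventually_sequentially by auto
    have "dist (poly (p m) z) (poly (p n) z) < r" if "m \<ge> N" "n \<ge> N" for m n
      using dist(1)[OF that(1) N(2)] dist(1)[OF that(2) N(2)] N(1)
        dist_triangle2[of "poly (p m) z" "poly (p n) z" "poly (p N) z"]
      by (simp add: dist_norm)
    then show "\<exists>M. \<forall>m\<ge>M. \<forall>n\<ge>M. dist (poly (p m) z) (poly (p n) z) < r" by blast
  qed
  then have lim: "(\<lambda>n. poly (p n) z) \<longlonglongrightarrow> f z" for z
    unfolding f_def by (simp add: Cauchy_convergent_iff convergent_LIMSEQ_iff)
  have flim: "(\<lambda>m. cmod (poly (p m) z - poly (p n) z)) \<longlonglongrightarrow> cmod (f z - poly (p n) z)" for z n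
    by (intro tendsto_intros lim)
  have fdist: "cmod (f z - poly (p n) z) \<le> e n" if "cmod z \<le> real n" for n z
    by (rule LIMSEQ_le_const2[OF flim]) (use dist(1) that in blast)
  have fdist': "cmod (f z - poly (p n) z) \<le> e n * cmod (z - complex_of_real a)"
    if "cmod z \<le> real n" "a \<in> D n" for n z a
    by (rule LIMSEQ_le_const2[OF flim]) (use dist(2) that in blast)
  have hol: "f holomorphic_on UNIV"
  proof (rule holomorphic_uniform_sequence)
    show "poly (p n) holomorphic_on UNIV" for n by (intro holomorphic_intros)
    fix w :: complex
    have "uniform_limit (cball w 1) (\<lambda>n. poly (p n)) f sequentially"
    proof (rule uniform_limitI)
      fix r :: real assume "r > 0"
      \<comment> \<open>From radius \<open>cmod w + 1\<close> on, the disc of radius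
        \<open>n\<close> contains the closed unit disc about \<open>w\<close>.\<close>
      from e_small[OF this, of "cmod w + 1"]
      show "eventually (\<lambda>n. \<forall>z\<in>cball w 1. dist (poly (p n) z) (f z) < r) sequentially"
      proof (rule eventually_mono, intro ballI)
        fix n z assume n: "e n < r \<and> cmod w + 1 \<le> real n" and "z \<in> cball w 1"
        then have "cmod z \<le> real n"
          using norm_triangle_ineq2[of z w] by (simp add: dist_norm norm_minus_commute)
        from fdist[OF this] n show "dist (poly (p n) z) (f z) < r"
          by (simp add: dist_norm norm_minus_commute)
      qed
    qed
    then show "\<exists>d>0. cball w d \<subseteq> UNIV \<and> uniform_limit (cball w d) (\<lambda>n. poly (p n)) f sequentially"
      by (intro exI[of _ 1]) auto
  qed auto
  have fD: "f (complex_of_real a) = ?v (p n) a" if "a \<in> D n" for a n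
  proof (rule LIMSEQ_unique[OF lim])
    have "eventually (\<lambda>m. ?v (p n) a = ?v (p m) a) sequentially"
      using eventually_ge_at_top[of n]
      by eventually_elim (use close that in \<open>auto simp: close_poly_def\<close>)
    then show "(\<lambda>m. ?v (p m) a) \<longlonglongrightarrow> ?v (p n) a" by (rule tendsto_eventually[OF eventually_mono]) auto
  qed
  \<comment> \<open>The slope \<open>2 * e n\<close> of the polynomial loses at most
    \<open>e n\<close> in passing to the limit.\<close>
  have sep: "e n * \<bar>x - a\<bar> \<le> cmod (f (complex_of_real x) - f (complex_of_real a))"
    if "a \<in> D n" "\<bar>x\<bar> \<le> real n" for n a x
  proof -
    have "cmod (f (complex_of_real x) - ?v (p n) x) \<le> e n * \<bar>x - a\<bar>"
      using fdist'[OF _ that(1), of "complex_of_real x"] that(2) by (metis norm_of_real of_real_diff)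
    moreover have "2 * e n * \<bar>x - a\<bar> \<le> cmod (?v (p n) x - f (complex_of_real a))"
      using st(4)[OF that] fD[OF that(1)] by simp
    moreover have "cmod (?v (p n) x - f (complex_of_real a)) \<le>
        cmod (f (complex_of_real x) - f (complex_of_real a)) + cmod (f (complex_of_real x) - ?v (p n) x)"
      using norm_triangle_ineq4[of "f (complex_of_real x) - f (complex_of_real a)" "f (complex_of_real x) - ?v (p n) x"]
      by (simp add: norm_minus_commute)
    ultimately show ?thesis by simp
  qed
  have AD: "\<exists>n. a \<in> D n \<and> r \<le> real n" if "a \<in> A" for a r
  proof -
    obtain k where "a = as k" using as \<open>a \<in> A\<close> by blast
    \<comment> \<open>The point \<open>as k\<close> is certain to be a node only after transition
      \<open>k\<close>, hence \<open>Suc k\<close>; a later stage makes the radius large as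
      well.\<close>
    then have "a \<in> D (max (Suc k) (nat \<lceil>r\<rceil>))" using step(4)[of k] Dmono by (meson max.cobounded1 subsetD)
    then show ?thesis by (intro exI[of _ "max (Suc k) (nat \<lceil>r\<rceil>)"]) linarith
  qed
  \<comment> \<open>Here \<open>x\<close> is an arbitrary real number, so this yields injectivity on
    \<open>A\<close> and, together with \<open>onto\<close>, excludes real preimages of
    \<open>B\<close> outside \<open>A\<close>.\<close>
  have uniq: "x = a" if "a \<in> A" "f (complex_of_real x) = f (complex_of_real a)" for a x
  proof -
    obtain n where n: "a \<in> D n" "\<bar>x\<bar> \<le> real n" using AD[OF \<open>a \<in> A\<close>] by blast
    show ?thesis using sep[OF n] that(2) st(2)[of n] by (simp add: mult_le_0_iff)
  qed
  have into: "f (complex_of_real a) \<in> B" if "a \<in> A" for a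
    using AD[OF that, of 0] fD st(3) by fastforce
  have onto: "\<exists>a\<in>A. f (complex_of_real a) = b" if "b \<in> B" for b
  proof -
    obtain k where "b = bs k" using bs \<open>b \<in> B\<close> by blast
    then obtain a where "a \<in> D (Suc k)" "b = ?v (p (Suc k)) a" using step(5)[of k] by auto
    then show ?thesis using fD st(1)[of "Suc k"] by (intro bexI[of _ a]) auto
  qed
  have "deriv f (complex_of_real a) \<noteq> 0" if "a \<in> A" for a
  proof
    assume d0: "deriv f (complex_of_real a) = 0"
    \<comment> \<open>The extra 1 keeps \<open>a + t\<close> within the range of \<open>sep\<close>
      for \<open>t \<le> 1\<close>.\<close>
    obtain n where n: "a \<in> D n" "\<bar>a\<bar> + 1 \<le> real n" using AD[OF \<open>a \<in> A\<close>] by blast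
    have "(f has_field_derivative 0) (at (complex_of_real a))"
      using holomorphic_derivI[OF hol, of "complex_of_real a"] d0 by simp
    then have "(f has_derivative (*) 0) (at (complex_of_real a))"
      by (simp add: has_field_derivative_def)
    \<comment> \<open>With derivative 0, increments near \<open>a\<close> have slope at most
      \<open>e n / 2\<close>, against the lower bound \<open>e n\<close> from
      \<open>sep\<close>.\<close>
    moreover have "e n / 2 > 0" using st(2)[of n] by simp
    ultimately obtain r where r: "r > 0" "\<And>y. cmod (y - complex_of_real a) < r \<Longrightarrow>
        cmod (f y - f (complex_of_real a)) \<le> e n / 2 * cmod (y - complex_of_real a)"
      unfolding has_derivative_at_alt by fastforce
    define t where "t = min 1 (r / 2)"
    have t: "0 < t" "t \<le> 1" "t < r" unfolding t_def using r(1) by auto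
    have "e n * t \<le> cmod (f (complex_of_real (a + t)) - f (complex_of_real a))"
      using sep[OF n(1), of "a + t"] n(2) t by simp
    also have "\<dots> \<le> e n / 2 * t" using r(2)[of "complex_of_real (a + t)"] t by simp
    finally show False using t(1) st(2)[of n] by simp
  qed
  moreover have "bij_betw f (complex_of_real ` A) B"
  proof (rule bij_betw_imageI)
    show "inj_on f (complex_of_real ` A)" by (rule inj_onI) (use uniq in auto)
    show "f ` complex_of_real ` A = B"
    proof
      show "f ` complex_of_real ` A \<subseteq> B" using into by auto
      show "B \<subseteq> f ` complex_of_real ` A" using onto by fast
    qed
  qed
  moreover have "f -` B \<inter> \<real> = complex_of_real ` A"
  proof
    show "complex_of_real ` A \<subseteq> f -` B \<inter> \<real>" using into by auto
    show "f -` B \<inter> \<real> \<subseteq> complex_of_real ` A"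
    proof
      fix z assume "z \<in> f -` B \<inter> \<real>"
      then obtain x where x: "z = complex_of_real x" "f (complex_of_real x) \<in> B"
        by (auto elim: Reals_cases)
      obtain a where "a \<in> A" "f (complex_of_real a) = f (complex_of_real x)"
        using onto[OF x(2)] by auto
      then show "z \<in> complex_of_real ` A" using uniq[of a x] x(1) by auto
    qed
  qed
  moreover have "transcendental_entire f"
    unfolding transcendental_entire_def
  proof (intro conjI hol notI)
    assume "\<exists>q. \<forall>z. f z = poly q z"
    then obtain q where "\<And>z. f z = poly q z" by blast
    then have "B \<subseteq> ?v q ` UNIV" using onto by fastforce
    then show False using poly_not_covers_dense[OF assms(4)] by blast
  qed
  ultimately show ?thesis by blast
qed

end
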